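(* Let $G$ be a connected graph with $n\ge 3$ vertices. Then $\ddot{\gamma}_P^k(G)\le (k+1)\frac{n}{3}$ for every integer $k\ge 0$. When $k=0$, equality holds if and only if $G\in \mathcal{T}\cup\{K_{3,3}\}$. When $k\ge 1$, equality holds if and only if $G\in\mathcal{T}$.
   Context: Graphs are finite and simple, with at least one vertex, and are considered up to isomorphism. For a vertex $v$, $N[v]$ denotes its closed neighborhood. The power domination process on a graph $G$ with initial set $S\subseteq V(G)$: (1) set $B=\bigcup_{v\in S}N[v]$; (2) while there is $v\in B$ with exactly one neighbor $u\notin B$, add $u$ to $B$. A set $S$ is a power dominating set of $G$ if $B=V(G)$ when the process terminates. A multiset of vertices is called a power dominating set if its underlying set is one. For an integer $k\ge 0$, a $k$-robust power dominating set of $G$ is a finite multiset $S$ of elements of $V(G)$ with $|S|\ge k$ (counted with multiplicity) such that for every submultiset $F$ of $S$ with $|F|=k$, the multiset difference $S\setminus F$ is a power dominating set of $G$. $\ddot{\gamma}_P^k(G)$ denotes the minimum cardinality (with multiplicity) of a $k$-robust power dominating set of $G$. $\mathcal{T}$ is the family of graphs obtained by taking a connected graph $H$ and, for each vertex $v\in V(H)$, adding two new vertices $v'$ and $v''$ and the two edges $vv'$ and $vv''$, with the edge $v'v''$ optional (independently for each $v$). $K_{3,3}$ is the complete bipartite graph with both parts of size 3. *)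

theory Defs
  imports
    "Graph_Theory.Digraph_Isomorphism"
    "Graph_Theory.Kuratowski"
    "HOL-Library.Multiset"
begin

text \<open>
  A finite simple graph is a digraph satisfying the locale predicate \<^const>\<open>graph\<close> (finite,
  loop-free, without parallel arcs, symmetric); an edge is represented by its two opposite arcs,
  so \<open>v\<close> and \<open>u\<close> are adjacent iff \<open>v \<rightarrow>\<^bsub>G\<^esub> u\<close>.
\<close>

definition closed_neighborhood :: "('a, 'b) pre_digraph \<Rightarrow> 'a \<Rightarrow> 'a set" where
  "closed_neighborhood G v = insert v {u. v \<rightarrow>\<^bsub>G\<^esub> u}"

definition forcing_step :: "('a, 'b) pre_digraph \<Rightarrow> 'a set \<Rightarrow> 'a set \<Rightarrow> bool" where
  "forcing_step G B B' \<longleftrightarrow>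
     (\<exists>v\<in>B. \<exists>u. {w. v \<rightarrow>\<^bsub>G\<^esub> w \<and> w \<notin> B} = {u} \<and> B' = insert u B)"

definition process_result :: "('a, 'b) pre_digraph \<Rightarrow> 'a set \<Rightarrow> 'a set \<Rightarrow> bool" where
  "process_result G S B \<longleftrightarrow>
     (forcing_step G)\<^sup>*\<^sup>* (\<Union>v\<in>S. closed_neighborhood G v) B \<and> (\<nexists>B'. forcing_step G B B')"

lemma forcing_run_subset:
  assumes "(forcing_step G)\<^sup>*\<^sup>* A B" "A \<subseteq> C" "\<nexists>C'. forcing_step G C C'"
  shows "B \<subseteq> C"
  using assms(1)
proof (induction rule: rtranclp_induct)
  case base
  then show ?case by fact
next
  case (step B B')
  obtain v u where vu: "v \<in> B" "{w. v \<rightarrow>\<^bsub>G\<^esub> w \<and> w \<notin> B} = {u}" "B' = insert u B"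
    using step.hyps(2) unfolding forcing_step_def by blast
  have "u \<in> C"
  proof (rule ccontr)
    assume "u \<notin> C"
    then have "{w. v \<rightarrow>\<^bsub>G\<^esub> w \<and> w \<notin> C} = {u}"
      using vu step.IH by blast
    then have "forcing_step G C (insert u C)"
      unfolding forcing_step_def using vu step.IH by blast
    then show False using assms(3) by blast
  qed
  then show ?case using vu step.IH by blast
qed

text \<open>The outcome of the process does not depend on the choices made along the way.\<close>

lemma forcing_run_increasing:
  assumes "(forcing_step G)\<^sup>*\<^sup>* A B"
  shows "A \<subseteq> B"
  using assms by (induction rule: rtranclp_induct) (auto simp: forcing_step_def)

lemma process_result_unique:
  assumes "process_result G S B" "process_result G S C"
  shows "B = C"
proof
  show "B \<subseteq> C"
    using assms forcing_run_subset forcing_run_increasing unfolding process_result_def by metis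
  show "C \<subseteq> B"
    using assms forcing_run_subset forcing_run_increasing unfolding process_result_def by metis
qed

definition power_dominating_set :: "('a, 'b) pre_digraph \<Rightarrow> 'a set \<Rightarrow> bool" where
  "power_dominating_set G S \<longleftrightarrow> S \<subseteq> verts G \<and> process_result G S (verts G)"

definition robust_power_dominating_set ::
    "nat \<Rightarrow> ('a, 'b) pre_digraph \<Rightarrow> 'a multiset \<Rightarrow> bool" where
  "robust_power_dominating_set k G S \<longleftrightarrow>
     set_mset S \<subseteq> verts G \<and> k \<le> size S \<and>
     (\<forall>F. F \<subseteq># S \<and> size F = k \<longrightarrow> power_dominating_set G (set_mset (S - F)))"

text \<open>
  On a finite graph the minimum is over a nonempty set: \<open>k + 1\<close> copies of every vertex form a
  \<open>k\<close>-robust power dominating set.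
\<close>

definition robust_power_domination_number :: "nat \<Rightarrow> ('a, 'b) pre_digraph \<Rightarrow> nat" where
  "robust_power_domination_number k G =
     (LEAST m. \<exists>S. robust_power_dominating_set k G S \<and> size S = m)"

datatype 'a leafed_vertex = Base 'a | Leaf1 'a | Leaf2 'a

text \<open>
  The new vertices \<open>v'\<close> and \<open>v''\<close> are \<open>Leaf1 v\<close> and \<open>Leaf2 v\<close>; the set \<open>A\<close> consists of those \<open>v\<close>
  for which the optional edge \<open>v'v''\<close> is present.
\<close>

definition add_two_leaves ::
    "'a pair_pre_digraph \<Rightarrow> 'a set \<Rightarrow> 'a leafed_vertex pair_pre_digraph" where
  "add_two_leaves H A =
     (let E = {(Base u, Base v) |u v. (u, v) \<in> parcs H}
            \<union> {(Base v, Leaf1 v) |v. v \<in> pverts H}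
            \<union> {(Base v, Leaf2 v) |v. v \<in> pverts H}
            \<union> {(Leaf1 v, Leaf2 v) |v. v \<in> A}
      in \<lparr> pverts = Base ` pverts H \<union> Leaf1 ` pverts H \<union> Leaf2 ` pverts H,
           parcs = E \<union> E\<inverse> \<rparr>)"

text \<open>
  Membership in the family is up to isomorphism.  Letting \<open>H\<close> range over graphs on the vertex type
  of \<open>G\<close> is no restriction, because \<open>H\<close> embeds into \<open>G\<close>.
\<close>

definition in_family_T :: "('a, 'b) pre_digraph \<Rightarrow> bool" where
  "in_family_T G \<longleftrightarrow>
     (\<exists>(H :: 'a pair_pre_digraph) A. pair_graph H \<and> Digraph_Component.connected (with_proj H) \<and>
        A \<subseteq> pverts H \<and> digraph_iso (with_proj (add_two_leaves H A)) G)"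

end

theory Submission
  imports Defs
begin

text \<open>
  On a path or cycle a single vertex suffices.  Otherwise choose a minimum power dominating set
  \<open>S\<close> of vertices of degree at least three that induces as few isolated vertices as possible.
   Each \<open>v \<in> S\<close> then has two neighbours seen by no other member of
  \<open>S\<close>, whence \<open>3 |S| \<le> n\<close>.  If equality holds, \<open>V\<close> is partitioned into the triples of a member of
  \<open>S\<close> and its two private neighbours.  Either no edge joins private neighbours of different members,
  and \<open>G\<close> lies in the family, or minimality of \<open>S\<close> forces two such pairs to be completely joined and
  isolated from the rest, and \<open>G\<close> is \<open>K\<^sub>3\<^sub>,\<^sub>3\<close>.  The robust bound takes \<open>k + 1\<close> copies of \<open>S\<close>.  It is
  attained on the family, because each triple must contain \<open>k + 1\<close> elements, but for \<open>k \<ge> 1\<close> not on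
  \<open>K\<^sub>3\<^sub>,\<^sub>3\<close>, where any two distinct vertices form a power dominating set.
\<close>

lemma submset_of_size_exists:
  assumes "k \<le> size M"
  shows "\<exists>F. F \<subseteq># M \<and> size F = k"
proof -
  obtain xs where "M = mset xs" using ex_mset by metis
  moreover have "mset (take k xs) \<subseteq># mset xs"
    by (metis append_take_drop_id mset_append mset_subset_eq_add_left)
  ultimately show ?thesis using assms by (intro exI[of _ "mset (take k xs)"]) simp
qed

section \<open>Private neighbours\<close>

locale connected_graph = graph +
  assumes connected: "connected G"
begin

definition nbrs :: "'a \<Rightarrow> 'a set" where
  "nbrs v = {u. v \<rightarrow> u}"

definition obs :: "'a set \<Rightarrow> 'a set" where
  "obs S = (\<Union>v\<in>S. closed_neighborhood G v)"

text \<open>These are the sets at which forcing is stuck. Counting the neighbours outside turns a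
  forcing step into a cardinality estimate, supplied by \<open>closedD\<close>.\<close>

definition closed :: "'a set \<Rightarrow> bool" where
  "closed C \<longleftrightarrow> C \<subseteq> verts G \<and> (\<forall>v\<in>C. card (nbrs v - C) \<noteq> 1)"

definition min_pds :: "'a set \<Rightarrow> bool" where
  "min_pds S \<longleftrightarrow> power_dominating_set G S \<and> (\<forall>S'. power_dominating_set G S' \<longrightarrow> card S \<le> card S')"

text \<open>External private neighbours: \<open>obs (S - {v})\<close> contains \<open>S - {v}\<close>, so none lies in \<open>S\<close>.\<close>

definition epn :: "'a set \<Rightarrow> 'a \<Rightarrow> 'a set" where
  "epn S v = nbrs v - obs (S - {v})"

lemma nbrs_verts: "u \<in> nbrs v \<Longrightarrow> u \<in> verts G" "u \<in> nbrs v \<Longrightarrow> v \<in> verts G"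
  by (auto simp: nbrs_def dest: adj_in_verts)

lemma finite_nbrs [simp]: "finite (nbrs v)"
  using nbrs_verts(1) finite_verts by (meson finite_subset subsetI)

lemma nbrs_sym: "u \<in> nbrs v \<Longrightarrow> v \<in> nbrs u"
  using arcs_ends_symmetric[OF sym_arcs] by (auto simp: nbrs_def)

lemma nbrs_irrefl [simp]: "v \<notin> nbrs v"
  using adj_not_same by (auto simp: nbrs_def)

lemma in_obs: "x \<in> obs S \<longleftrightarrow> x \<in> S \<or> (\<exists>v\<in>S. x \<in> nbrs v)"
  by (auto simp: obs_def closed_neighborhood_def nbrs_def)

lemma obs_verts: "S \<subseteq> verts G \<Longrightarrow> obs S \<subseteq> verts G"
  using nbrs_verts(1) by (auto simp: in_obs)

section \<open>Forcing runs and closed sets\<close>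

lemma closedD:
  assumes "closed C" "v \<in> C" "card (nbrs v - C) \<le> 1"
  shows "nbrs v \<subseteq> C"
proof -
  have "card (nbrs v - C) = 0"
    using assms by (auto simp: closed_def le_Suc_eq)
  then show ?thesis by simp
qed

lemma closed_iff_stuck: "closed C \<longleftrightarrow> C \<subseteq> verts G \<and> (\<nexists>C'. forcing_step G C C')"
proof -
  have "nbrs v - C = {w. v \<rightarrow> w \<and> w \<notin> C}" for v
    by (auto simp: nbrs_def)
  then show ?thesis
    by (simp add: closed_def forcing_step_def card_1_singleton_iff) blast
qed

lemma forcing_step_card:
  assumes "forcing_step G B B'" "B \<subseteq> verts G"
  shows "B' \<subseteq> verts G \<and> card B < card B'"
proof -
  obtain v u where *: "v \<in> B" "{w. v \<rightarrow> w \<and> w \<notin> B} = {u}" "B' = insert u B"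
    using assms by (auto simp: forcing_step_def)
  then have "v \<rightarrow> u" "u \<notin> B" by auto
  then show ?thesis
    using * assms(2) finite_subset[OF assms(2) finite_verts] by (auto dest: adj_in_verts)
qed

text \<open>Every step enlarges the set within the finite vertex set, so a reachable set of greatest
  cardinality admits no further step.\<close>

lemma run_terminates:
  assumes "A \<subseteq> verts G"
  obtains B where "(forcing_step G)\<^sup>*\<^sup>* A B" "closed B"
proof -
  let ?P = "\<lambda>B. (forcing_step G)\<^sup>*\<^sup>* A B \<and> B \<subseteq> verts G"
  have "card B < Suc (card (verts G))" if "?P B" for B
    using that by (simp add: card_mono less_Suc_eq_le)
  then obtain B where B: "?P B" "\<forall>B'. ?P B' \<longrightarrow> card B' \<le> card B"
    using ex_has_greatest_nat[of ?P A card "Suc (card (verts G))"] assms by blast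
  have "closed B"
    unfolding closed_iff_stuck
    using B forcing_step_card[of B] by (meson linorder_not_less rtranclp.rtrancl_into_rtrancl)
  then show ?thesis using that B by blast
qed

text \<open>Forcing never leaves a closed set that contains \<open>obs S\<close>, and it ends in a
  closed set; its outcome is the least closed superset of \<open>obs S\<close>. From here on,
  arguments push vertices into an arbitrary closed \<open>C\<close> or exhibit a proper one.\<close>

lemma pds_iff:
  "power_dominating_set G S \<longleftrightarrow>
     S \<subseteq> verts G \<and> (\<forall>C. closed C \<longrightarrow> obs S \<subseteq> C \<longrightarrow> verts G \<subseteq> C)"
proof (intro iffI conjI allI impI)
  assume "power_dominating_set G S"
  then show "S \<subseteq> verts G" by (simp add: power_dominating_set_def)
next
  fix C assume "power_dominating_set G S" "closed C" "obs S \<subseteq> C"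
  then show "verts G \<subseteq> C"
    using forcing_run_subset
    unfolding power_dominating_set_def process_result_def obs_def closed_iff_stuck by blast
next
  assume *: "S \<subseteq> verts G \<and> (\<forall>C. closed C \<longrightarrow> obs S \<subseteq> C \<longrightarrow> verts G \<subseteq> C)"
  then obtain B where B: "(forcing_step G)\<^sup>*\<^sup>* (obs S) B" "closed B"
    using run_terminates[OF obs_verts] by blast
  moreover have "B = verts G"
    using * B forcing_run_increasing[OF B(1)] by (auto simp: closed_def)
  ultimately show "power_dominating_set G S"
    using * by (simp add: power_dominating_set_def process_result_def obs_def closed_iff_stuck)
qed

lemma pds_verts: "power_dominating_set G (verts G)"
  unfolding pds_iff by (auto simp: in_obs)

lemma pds_finite: "power_dominating_set G S \<Longrightarrow> finite S"
  using finite_subset[OF _ finite_verts] by (auto simp: pds_iff)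

lemma pds_nonempty: "\<not> power_dominating_set G {}"
proof -
  have "verts G \<noteq> {}"
    using connected by (auto simp: connected_conv)
  moreover have "closed {}" "obs {} = {}" by (auto simp: closed_def obs_def)
  ultimately show ?thesis unfolding pds_iff by blast
qed

text \<open>Every vertex is reached by a walk from \<open>x\<close>, as a connected symmetric
  digraph is strongly connected, and no walk from \<open>x\<close> leaves \<open>X\<close>.\<close>

lemma connected_closed:
  assumes "x \<in> X" "x \<in> verts G" "\<And>v. v \<in> X \<Longrightarrow> nbrs v \<subseteq> X"
  shows "verts G \<subseteq> X"
proof
  fix y assume "y \<in> verts G"
  then have "x \<rightarrow>\<^sup>* y"
    using symmetric_connected_imp_strongly_connected[OF sym_arcs connected] assms(2) by auto
  then show "y \<in> X"
  proof (induct rule: reachable_induct)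
    case (step x y)
    then show ?case using assms(3) by (auto simp: nbrs_def)
  qed (use assms in auto)
qed

text \<open>\<open>d\<close> is the distance to \<open>c\<close>. Only its decrease towards some
  neighbour is recorded, to measure progress when vertices are moved towards
  \<open>c\<close>.\<close>

lemma distance_function:
  assumes "c \<in> verts G"
  obtains d :: "'a \<Rightarrow> nat" where "\<And>v. v \<in> verts G \<Longrightarrow> v \<noteq> c \<Longrightarrow> \<exists>x\<in>nbrs v. d x < d v"
proof -
  define d where "d v = (LEAST n. (v, c) \<in> arcs_ends G ^^ n)" for v
  have "\<exists>x\<in>nbrs v. d x < d v" if v: "v \<in> verts G" "v \<noteq> c" for v
  proof -
    have "v \<rightarrow>\<^sup>* c"
      using symmetric_connected_imp_strongly_connected[OF sym_arcs connected] assms v by auto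
    then have "\<exists>n. (v, c) \<in> arcs_ends G ^^ n"
      using reachable_rtranclI rtrancl_imp_relpow by fastforce
    then have dv: "(v, c) \<in> arcs_ends G ^^ d v"
      unfolding d_def by (rule LeastI_ex)
    with v obtain m where m: "d v = Suc m" by (cases "d v") auto
    then obtain x where x: "v \<rightarrow> x" "(x, c) \<in> arcs_ends G ^^ m"
      using dv by (metis relpow_Suc_D2)
    then have "d x \<le> m" unfolding d_def by (intro Least_le)
    then show ?thesis using x m by (auto simp: nbrs_def)
  qed
  then show ?thesis using that by blast
qed

section \<open>Minimum power dominating sets and exchanges\<close>

lemma min_pdsD: "min_pds S \<Longrightarrow> card S' < card S \<Longrightarrow> \<not> power_dominating_set G S'"
  by (auto simp: min_pds_def)

lemma min_pdsI:
  "min_pds S \<Longrightarrow> power_dominating_set G S' \<Longrightarrow> card S' \<le> card S \<Longrightarrow> min_pds S'"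
  unfolding min_pds_def by (meson order_trans)

lemma min_pds_exists: "\<exists>S. min_pds S"
  using ex_has_least_nat[of "power_dominating_set G" "verts G" card] pds_verts
  by (auto simp: min_pds_def)

text \<open>In a closed \<open>C\<close> containing \<open>obs S'\<close>, \<open>v\<close> has at
  most one neighbour missing and forces it, which recovers all that \<open>v\<close> contributes to
  \<open>obs S\<close>. Asking for \<open>v\<close> in every such \<open>C\<close>, rather than in
  \<open>obs S'\<close>, lets a failed exchange deliver a \<open>C\<close> that avoids
  \<open>v\<close>.\<close>

lemma pds_exchange:
  assumes "power_dominating_set G S" "S' \<subseteq> verts G" "S - {v} \<subseteq> S'"
    and "\<And>C. closed C \<Longrightarrow> obs S' \<subseteq> C \<Longrightarrow> v \<in> C"
    and "card (nbrs v - obs S') \<le> 1"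
  shows "power_dominating_set G S'"
  unfolding pds_iff
proof (intro conjI allI impI)
  fix C assume C: "closed C" "obs S' \<subseteq> C"
  have v: "v \<in> C" using assms(4) C by blast
  have "card (nbrs v - C) \<le> card (nbrs v - obs S')"
    using C by (intro card_mono) auto
  then have "nbrs v \<subseteq> C"
    using closedD C v assms(5) by simp
  then have "obs S \<subseteq> C"
    using v C assms(3) unfolding in_obs[abs_def] subset_iff by (metis Diff_iff singletonD)
  then show "verts G \<subseteq> C"
    using assms(1) C by (auto simp: pds_iff)
qed (use assms in auto)

text \<open>A vertex of degree at most two can be traded for any of its neighbours, so it can be moved
  along a path until it meets a vertex of larger degree or reaches \<open>c\<close>.\<close>

lemma min_pds_high_degree:
  assumes "c \<in> verts G"
  shows "\<exists>S. min_pds S \<and> (\<forall>v\<in>S. card (nbrs v) \<le> 2 \<longrightarrow> v = c)"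
proof -
  obtain d :: "'a \<Rightarrow> nat" where d: "\<And>v. v \<in> verts G \<Longrightarrow> v \<noteq> c \<Longrightarrow> \<exists>x\<in>nbrs v. d x < d v"
    using distance_function[OF assms] by blast
  \<comment> \<open>The weight charges only the members to be removed. Moving a charged member to a
    nearer neighbour lowers the sum, whatever the degree of that neighbour.\<close>
  define w where "w v = (if card (nbrs v) \<le> 2 \<and> v \<noteq> c then d v else 0)" for v
  obtain S where S: "min_pds S" "\<And>S'. min_pds S' \<Longrightarrow> sum w S \<le> sum w S'"
    using ex_has_least_nat[of min_pds _ "sum w"] min_pds_exists by metis
  have fS: "finite S" and SV: "S \<subseteq> verts G" and pS: "power_dominating_set G S"
    using S(1) pds_finite by (auto simp: min_pds_def pds_iff)
  have False if v: "v \<in> S" "card (nbrs v) \<le> 2" "v \<noteq> c" for v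
  proof -
    obtain x where x: "x \<in> nbrs v" "d x < d v" using d v SV by blast
    define S' where "S' = insert x (S - {v})"
    have "v \<in> obs S'" using x nbrs_sym by (auto simp: in_obs S'_def)
    \<comment> \<open>\<open>v\<close> has at most two neighbours and \<open>x\<close> is now in
      \<open>S'\<close>, so at most one is left to force.\<close>
    moreover have "card (nbrs v - obs S') \<le> card (nbrs v - {x})"
      by (intro card_mono) (auto simp: in_obs S'_def)
    ultimately have p: "power_dominating_set G S'"
      using v x nbrs_verts(1) SV
      by (intro pds_exchange[OF pS, of S' v]) (auto simp: S'_def)
    have "x \<notin> S"
    proof
      assume "x \<in> S"
      then have "S' = S - {v}" using x by (auto simp: S'_def)
      then have "card S' < card S" using fS v by (metis card_Diff1_less)
      then show False using p S(1) min_pdsD by blast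
    qed
    then have "card S' = card S"
      using fS v by (metis S'_def card_Suc_Diff1 card_insert_disjoint finite_Diff Diff_iff)
    then have "sum w S \<le> sum w S'" using S p min_pdsI by simp
    moreover have "sum w S' = w x + sum w (S - {v})" "sum w S = w v + sum w (S - {v})"
      using fS v \<open>x \<notin> S\<close> by (auto simp: S'_def sum.remove)
    moreover have "w x < w v" using x v by (auto simp: w_def)
    ultimately show False by simp
  qed
  then show ?thesis using S(1) by blast
qed

lemma nbr_inside:
  assumes "card (nbrs v - X) \<le> 1" "2 < card (nbrs v)"
  shows "\<exists>u\<in>nbrs v. u \<in> X"
proof (rule ccontr)
  assume "\<not> ?thesis"
  then have "nbrs v - X = nbrs v" by blast
  then show False using assms by simp
qed

text \<open>Among the minimum power dominating sets of vertices of degree at least three, one with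
  fewest isolated vertices (in the subgraph it induces) has the required private neighbours:
  an isolated member without them could be traded for a neighbour that is adjacent to another member.\<close>

lemma private_neighbors_degree_3:
  assumes "min_pds S0" "\<forall>v\<in>S0. 2 < card (nbrs v)"
  shows "\<exists>S. min_pds S \<and> (\<forall>v\<in>S. 2 < card (nbrs v)) \<and> (\<forall>v\<in>S. 2 \<le> card (epn S v))"
proof -
  define isolated where "isolated S = {v\<in>S. nbrs v \<inter> S = {}}" for S
  define P where "P S \<longleftrightarrow> min_pds S \<and> (\<forall>v\<in>S. 2 < card (nbrs v))" for S
  obtain S where S: "P S" "\<And>S'. P S' \<Longrightarrow> card (isolated S) \<le> card (isolated S')"
    using ex_has_least_nat[of P S0 "\<lambda>S. card (isolated S)"] assms unfolding P_def by metis
  have mS: "min_pds S" and deg: "\<And>v. v \<in> S \<Longrightarrow> 2 < card (nbrs v)"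
    using S by (auto simp: P_def)
  have fS: "finite S" and SV: "S \<subseteq> verts G" and pS: "power_dominating_set G S"
    using mS pds_finite by (auto simp: min_pds_def pds_iff)
  have "2 \<le> card (epn S v)" if v: "v \<in> S" for v
  proof (rule ccontr)
    assume "\<not> ?thesis"
    then have e: "card (nbrs v - obs (S - {v})) \<le> 1" by (simp add: epn_def)
    have lt: "card (S - {v}) < card S" using fS v by (meson card_Diff1_less)
    have npds: "\<not> power_dominating_set G (S - {v})"
      using min_pdsD[OF mS lt] .
    \<comment> \<open>If every closed superset of \<open>obs (S - {v})\<close> contained
      \<open>v\<close>, the exchange lemma would make the smaller set \<open>S - {v}\<close> power
      dominating.\<close>
    then obtain C where C: "closed C" "obs (S - {v}) \<subseteq> C" "v \<notin> C"
      using pds_exchange[OF pS, of "S - {v}" v] e SV by blast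
    have iso: "nbrs v \<inter> S = {}"
    proof (rule ccontr)
      assume "nbrs v \<inter> S \<noteq> {}"
      then obtain u where "u \<in> S - {v}" "v \<in> nbrs u" using nbrs_sym nbrs_irrefl by blast
      then show False using C by (auto simp: in_obs subset_iff)
    qed
    obtain u where u: "u \<in> nbrs v" "u \<in> obs (S - {v})"
      using nbr_inside[OF e deg[OF v]] by blast
    then have uS: "u \<notin> S" using iso by blast
    with u obtain w where w: "w \<in> S" "w \<noteq> v" "u \<in> nbrs w" by (auto simp: in_obs)
    have vu: "v \<in> nbrs u" "w \<in> nbrs u" using u w nbrs_sym by auto
    show False
    \<comment> \<open>Trading \<open>v\<close> for \<open>u\<close> respects the degree condition
      only in the first case. In the second, \<open>v\<close> and \<open>w\<close> are the only
      neighbours of \<open>u\<close>, and \<open>u\<close> forces \<open>v\<close> into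
      \<open>C\<close>.\<close>
    proof (cases "2 < card (nbrs u)")
      case True
      define S' where "S' = insert u (S - {v})"
      have "card (nbrs v - obs S') \<le> card (nbrs v - obs (S - {v}))"
        by (intro card_mono) (auto simp: in_obs S'_def)
      moreover have "v \<in> obs S'" using vu by (auto simp: in_obs S'_def)
      ultimately have p: "power_dominating_set G S'"
        using e u nbrs_verts(1) SV
        by (intro pds_exchange[OF pS, of S' v]) (auto simp: S'_def)
      have "card S' = card S"
        using fS v uS by (metis S'_def card_Suc_Diff1 card_insert_disjoint finite_Diff Diff_iff)
      then have "P S'" using p mS min_pdsI deg True by (auto simp: P_def S'_def)
      \<comment> \<open>\<open>v\<close> leaves the isolated members, \<open>u\<close> does not join
        them because of \<open>w\<close>, and no other member loses a neighbour, since
        \<open>v\<close> had none in \<open>S\<close>.\<close>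
      moreover have "isolated S' \<subset> isolated S"
      proof -
        have "w \<in> nbrs u \<inter> S'" using vu w by (auto simp: S'_def)
        then have "u \<notin> isolated S'" by (auto simp: isolated_def)
        then have "isolated S' \<subseteq> isolated S - {v}"
          using iso nbrs_sym by (auto simp: isolated_def S'_def)
        moreover have "v \<in> isolated S" using v iso by (auto simp: isolated_def)
        ultimately show ?thesis by blast
      qed
      then have "card (isolated S') < card (isolated S)"
        using fS by (intro psubset_card_mono) (auto simp: isolated_def)
      ultimately show False using S(2) by fastforce
    next
      case False
      have "u \<in> C" using u C by blast
      have "w \<in> C" using w C by (auto simp: in_obs subset_iff)
      have "nbrs u - C \<subseteq> nbrs u - {w}" using \<open>w \<in> C\<close> by auto
      then have "card (nbrs u - C) \<le> card (nbrs u - {w})" by (intro card_mono) auto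
      then have "nbrs u \<subseteq> C" using False vu closedD[OF C(1) \<open>u \<in> C\<close>] by simp
      then show False using vu C by blast
    qed
  qed
  then show ?thesis using mS deg by blast
qed

text \<open>If all degrees were at most one, a vertex and its neighbours would be closed under
  adjacency and hence be the whole graph, of at most two vertices.\<close>

lemma degree_2_vertex:
  assumes "3 \<le> card (verts G)"
  obtains c where "c \<in> verts G" "2 \<le> card (nbrs c)"
proof (rule ccontr)
  assume "\<not> thesis"
  with that have low: "card (nbrs v) \<le> 1" if "v \<in> verts G" for v
    using \<open>v \<in> verts G\<close> by fastforce
  obtain v where v: "v \<in> verts G" using assms by fastforce
  have "nbrs u \<subseteq> insert v (nbrs v)" if u: "u \<in> nbrs v" for u
  proof -
    have "v \<in> nbrs u" "card (nbrs u) \<le> 1" using u nbrs_sym low nbrs_verts(1) by auto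
    then show ?thesis
      by (metis One_nat_def card_le_Suc0_iff_eq finite_nbrs insertCI subsetI)
  qed
  then have "verts G \<subseteq> insert v (nbrs v)"
    using v by (intro connected_closed[of v]) auto
  then have "card (verts G) \<le> card (insert v (nbrs v))" by (intro card_mono) auto
  then show False using low[OF v] assms by simp
qed

text \<open>The alternative \<open>card S = 1\<close> covers paths and cycles: all degrees are at
  most two, so \<open>S\<close> shrinks to \<open>{c}\<close>, and both neighbours of
  \<open>c\<close> are private because nobody else observes anything.\<close>

lemma private_neighbors:
  assumes "3 \<le> card (verts G)"
  shows "\<exists>S. min_pds S \<and> (\<forall>v\<in>S. 2 \<le> card (epn S v)) \<and>
    ((\<forall>v\<in>S. 2 < card (nbrs v)) \<or> card S = 1)"
proof (cases "\<exists>c\<in>verts G. 2 < card (nbrs c)")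
  case True
  then obtain c where c: "c \<in> verts G" "2 < card (nbrs c)" by blast
  obtain S where "min_pds S" "\<forall>v\<in>S. 2 < card (nbrs v)"
    using min_pds_high_degree[OF c(1)] c(2) by (metis linorder_not_le)
  then show ?thesis using private_neighbors_degree_3 by blast
next
  case False
  obtain c where c: "c \<in> verts G" "2 \<le> card (nbrs c)" using degree_2_vertex[OF assms] .
  then obtain S where S: "min_pds S" "\<forall>v\<in>S. card (nbrs v) \<le> 2 \<longrightarrow> v = c"
    using min_pds_high_degree by blast
  have "S \<subseteq> verts G" "S \<noteq> {}" using S pds_nonempty by (auto simp: min_pds_def pds_iff)
  then have "S = {c}" using S(2) False by force
  then show ?thesis using S(1) c by (auto simp: epn_def obs_def)
qed


section \<open>The extremal graphs\<close>

lemma epn_disjoint: "v \<in> S \<Longrightarrow> u \<in> S \<Longrightarrow> u \<noteq> v \<Longrightarrow> epn S u \<inter> epn S v = {}"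
  by (auto simp: epn_def in_obs)

lemma epn_outside: "epn S v \<inter> S = {}"
  by (auto simp: epn_def in_obs)

lemma finite_epn [simp]: "finite (epn S v)"
  by (simp add: epn_def)

lemma epn_verts: "epn S v \<subseteq> verts G"
  using nbrs_verts(1) by (auto simp: epn_def)

lemma epn_adjacent: "x \<in> epn S v \<Longrightarrow> x \<in> nbrs v"
  by (simp add: epn_def)

lemma epn_not_adjacent: "x \<in> epn S v \<Longrightarrow> u \<in> S \<Longrightarrow> u \<noteq> v \<Longrightarrow> x \<notin> nbrs u"
  by (auto simp: epn_def in_obs)

lemma card_with_private_neighbors:
  assumes "finite S"
  shows "card (S \<union> (\<Union>v\<in>S. epn S v)) = card S + (\<Sum>v\<in>S. card (epn S v))"
proof -
  have "card (\<Union>v\<in>S. epn S v) = (\<Sum>v\<in>S. card (epn S v))"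
    using assms epn_disjoint by (intro card_UN_disjoint) auto
  moreover have "S \<inter> (\<Union>v\<in>S. epn S v) = {}" using epn_outside by blast
  ultimately show ?thesis using assms by (simp add: card_Un_disjoint)
qed

text \<open>Members and their private neighbours are all distinct, which gives at least three
  vertices per member. Equality leaves room neither for another vertex nor for a third private
  neighbour.\<close>

lemma card_private_bound:
  assumes "S \<subseteq> verts G" "\<forall>v\<in>S. 2 \<le> card (epn S v)"
  shows "3 * card S \<le> card (verts G)"
    and "3 * card S = card (verts G) \<Longrightarrow> verts G = S \<union> (\<Union>v\<in>S. epn S v)"
    and "3 * card S = card (verts G) \<Longrightarrow> v \<in> S \<Longrightarrow> card (epn S v) = 2"
proof -
  have fS: "finite S" using assms finite_subset[OF _ finite_verts] by blast
  let ?T = "S \<union> (\<Union>v\<in>S. epn S v)"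
  have "(\<Sum>v\<in>S. 2) \<le> (\<Sum>v\<in>S. card (epn S v))" using assms by (intro sum_mono) auto
  then have low: "2 * card S \<le> (\<Sum>v\<in>S. card (epn S v))" by simp
  have sub: "?T \<subseteq> verts G" using assms epn_verts by blast
  have up: "card ?T \<le> card (verts G)" using sub by (intro card_mono) auto
  show "3 * card S \<le> card (verts G)"
    using low up card_with_private_neighbors[OF fS] by simp
  assume eq: "3 * card S = card (verts G)"
  have "card (verts G) \<le> card ?T" using low eq card_with_private_neighbors[OF fS] by simp
  then show "verts G = ?T" using sub by (metis card_seteq finite_verts)
  show "card (epn S v) = 2" if "v \<in> S"
  proof (rule ccontr)
    assume "card (epn S v) \<noteq> 2"
    then have "(\<Sum>v\<in>S. 2) < (\<Sum>v\<in>S. card (epn S v))"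
      using assms that fS by (intro sum_strict_mono_ex1) (auto simp: order_le_less)
    then show False using eq up card_with_private_neighbors[OF fS] by simp
  qed
qed

text \<open>The base graph \<open>H\<close> is induced by \<open>S\<close>, and \<open>A\<close>
  collects the centres whose two leaves are adjacent. The condition on the leaves ensures that all
  other edges are those of the construction.\<close>

lemma in_family_T_I:
  fixes S :: "'a set"
  assumes SV: "S \<subseteq> verts G" "S \<noteq> {}"
    and V: "verts G = S \<union> l1 ` S \<union> l2 ` S"
    and inj: "inj_on l1 S" "inj_on l2 S"
    and disj: "S \<inter> l1 ` S = {}" "S \<inter> l2 ` S = {}" "l1 ` S \<inter> l2 ` S = {}"
    and adj: "\<And>v. v \<in> S \<Longrightarrow> l1 v \<in> nbrs v" "\<And>v. v \<in> S \<Longrightarrow> l2 v \<in> nbrs v"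
    and leaf: "\<And>v. v \<in> S \<Longrightarrow> nbrs (l1 v) \<subseteq> {v, l2 v}" "\<And>v. v \<in> S \<Longrightarrow> nbrs (l2 v) \<subseteq> {v, l1 v}"
  shows "in_family_T G"
proof -
  define A where "A = {v\<in>S. l2 v \<in> nbrs (l1 v)}"
  define H where "H = \<lparr>pverts = S, parcs = {(u, v). u \<in> S \<and> v \<in> S \<and> v \<in> nbrs u}\<rparr>"
  have H: "pverts H = S" "parcs H = {(u, v). u \<in> S \<and> v \<in> S \<and> v \<in> nbrs u}"
    by (auto simp: H_def)
  have fS: "finite S" using SV finite_subset[OF _ finite_verts] by blast
  have fin: "finite (parcs H)"
    using fS by (auto intro: finite_subset[of _ "S \<times> S"] simp: H)
  have sym: "symmetric (with_proj H)"
    by (auto simp: symmetric_def sym_def H intro: nbrs_sym)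
  have pg: "pair_graph H"
    using fS fin sym by unfold_locales (auto simp: H)
  interpret H: pair_graph H by (rule pg)
  have conn: "Digraph_Component.connected (with_proj H)"
    unfolding connected_conv
  proof (intro conjI ballI)
    show "verts (with_proj H) \<noteq> {}" using SV by (simp add: H)
    fix u v assume uv: "u \<in> verts (with_proj H)" "v \<in> verts (with_proj H)"
    \<comment> \<open>\<open>X\<close> is the component of \<open>u\<close> in \<open>H\<close>.
      Together with its leaves it is closed under adjacency in \<open>G\<close>, since a leaf sees
      no centre but its own; connectedness of \<open>G\<close> then puts all of \<open>S\<close>
      into \<open>X\<close>.\<close>
    define X where "X = {x\<in>S. (u, x) \<in> rtrancl_on S ((parcs H)\<^sup>s)}"
    have uX: "u \<in> X" using uv by (auto simp: X_def H)
    have step: "y \<in> X" if "x \<in> X" "y \<in> S" "y \<in> nbrs x" for x y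
    proof -
      have "(x, y) \<in> (parcs H)\<^sup>s" using that by (auto simp: X_def H symcl_def)
      then show ?thesis using that by (auto simp: X_def intro: rtrancl_on_into_rtrancl_on)
    qed
    have "nbrs x \<subseteq> X \<union> l1 ` X \<union> l2 ` X" if "x \<in> X" for x
    proof
      fix y assume y: "y \<in> nbrs x"
      then consider "y \<in> S" | s where "s \<in> S" "y = l1 s" | s where "s \<in> S" "y = l2 s"
        using V nbrs_verts(1) by blast
      then show "y \<in> X \<union> l1 ` X \<union> l2 ` X"
      proof cases
        case 1 then show ?thesis using step that y by blast
      next
        case (2 s)
        then have "x = s" using leaf(1)[of s] nbrs_sym[OF y] that disj by (auto simp: X_def)
        then show ?thesis using that 2 by blast
      next
        case (3 s)
        then have "x = s" using leaf(2)[of s] nbrs_sym[OF y] that disj by (auto simp: X_def)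
        then show ?thesis using that 3 by blast
      qed
    qed
    moreover have "nbrs (l1 x) \<subseteq> X \<union> l1 ` X \<union> l2 ` X" "nbrs (l2 x) \<subseteq> X \<union> l1 ` X \<union> l2 ` X"
      if "x \<in> X" for x
      using leaf[of x] that by (auto simp: X_def)
    ultimately have "verts G \<subseteq> X \<union> l1 ` X \<union> l2 ` X"
      using uX uv SV by (intro connected_closed[of u]) (blast | simp add: H subset_iff)+
    moreover have "l1 ` X \<subseteq> l1 ` S" "l2 ` X \<subseteq> l2 ` S" by (auto simp: X_def)
    moreover have "v \<in> S" "v \<in> verts G" using uv SV by (auto simp: H)
    ultimately have "v \<in> X" using disj by blast
    then show "(u, v) \<in> rtrancl_on (verts (with_proj H)) ((arcs_ends (with_proj H))\<^sup>s)"
      by (simp add: X_def H)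
  qed
  define T where "T = add_two_leaves H A"
  define f where "f x = (case x of Base v \<Rightarrow> v | Leaf1 v \<Rightarrow> l1 v | Leaf2 v \<Rightarrow> l2 v)" for x
  have f: "f (Base v) = v" "f (Leaf1 v) = l1 v" "f (Leaf2 v) = l2 v" for v
    by (simp_all add: f_def)
  have Tv: "pverts T = Base ` S \<union> Leaf1 ` S \<union> Leaf2 ` S"
    by (simp add: T_def add_two_leaves_def Let_def H)
  define E where "E = {(Base u, Base v) |u v. u \<in> S \<and> v \<in> S \<and> v \<in> nbrs u}
            \<union> {(Base v, Leaf1 v) |v. v \<in> S}
            \<union> {(Base v, Leaf2 v) |v. v \<in> S}
            \<union> {(Leaf1 v, Leaf2 v) |v. v \<in> A}"
  have Te: "parcs T = E \<union> E\<inverse>"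
    by (simp add: T_def add_two_leaves_def Let_def H E_def)
  have inj_f: "inj_on f (pverts T)"
  proof -
    have "inj_on f (Base ` S)" "inj_on f (Leaf1 ` S)" "inj_on f (Leaf2 ` S)"
      using inj by (auto simp: inj_on_def f)
    moreover have "f ` Base ` S = S" "f ` Leaf1 ` S = l1 ` S" "f ` Leaf2 ` S = l2 ` S"
      by (simp_all add: image_image f)
    ultimately show ?thesis
      using disj unfolding Tv inj_on_Un by blast
  qed
  have img_f: "f ` pverts T = verts G"
    unfolding Tv V image_Un image_image f by simp
  have E_sub: "E \<subseteq> pverts T \<times> pverts T" by (auto simp: E_def Tv A_def)
  have E_adj: "f y \<in> nbrs (f x)" if "(x, y) \<in> E" for x y
    using that adj by (auto simp: E_def f A_def)
  have arcs_img: "(\<lambda>(x, y). (f x, f y)) ` parcs T = arcs_ends G"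
  proof (intro equalityI subrelI)
    fix a b assume "(a, b) \<in> (\<lambda>(x, y). (f x, f y)) ` parcs T"
    then show "(a, b) \<in> arcs_ends G"
      using E_adj nbrs_sym unfolding Te by (auto simp: nbrs_def)
  next
    fix a b assume "(a, b) \<in> arcs_ends G"
    then have ab: "b \<in> nbrs a" "a \<in> nbrs b" using nbrs_sym by (auto simp: nbrs_def)
    have *: "(a, b) \<in> (\<lambda>(x, y). (f x, f y)) ` (E \<union> E\<inverse>)"
      if "(x, y) \<in> E \<union> E\<inverse>" "f x = a" "f y = b" for x y
      using that(1) by (rule rev_image_eqI) (simp add: that)
    have aV: "a \<in> verts G" and bV: "b \<in> verts G" using ab nbrs_verts by auto
    \<comment> \<open>By symmetry, an arc that does not join two centres can be read from a leaf
      end, whose possible neighbours are listed in \<open>leaf\<close>.\<close>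
    have leaf_case: "\<exists>x y. (x, y) \<in> E \<union> E\<inverse> \<and> f x = p \<and> f y = q"
      if "p \<in> verts G - S" "q \<in> nbrs p" for p q
    proof -
      have "p \<in> l1 ` S \<or> p \<in> l2 ` S" using that(1) unfolding V by blast
      then consider s where "s \<in> S" "p = l1 s" | s where "s \<in> S" "p = l2 s" by blast
      then show ?thesis
      proof cases
        case (1 s)
        show ?thesis
        proof (cases "q = s")
          case True
          have "(Leaf1 s, Base s) \<in> E \<union> E\<inverse>" using 1 by (auto simp: E_def)
          then show ?thesis using f True 1 by blast
        next
          case False
          then have "q = l2 s" "s \<in> A" using leaf(1)[of s] 1 that by (auto simp: A_def)
          then have "(Leaf1 s, Leaf2 s) \<in> E \<union> E\<inverse>" by (auto simp: E_def)
          then show ?thesis using f \<open>q = l2 s\<close> 1 by blast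
        qed
      next
        case (2 s)
        show ?thesis
        proof (cases "q = s")
          case True
          have "(Leaf2 s, Base s) \<in> E \<union> E\<inverse>" using 2 by (auto simp: E_def)
          then show ?thesis using f True 2 by blast
        next
          case False
          then have "q = l1 s" using leaf(2)[of s] 2 that by auto
          then have "s \<in> A" using 2 that nbrs_sym by (auto simp: A_def)
          then have "(Leaf2 s, Leaf1 s) \<in> E \<union> E\<inverse>" by (auto simp: E_def)
          then show ?thesis using f \<open>q = l1 s\<close> 2 by blast
        qed
      qed
    qed
    show "(a, b) \<in> (\<lambda>(x, y). (f x, f y)) ` parcs T"
    proof (cases "a \<in> S \<and> b \<in> S")
      case True
      then have "(Base a, Base b) \<in> E \<union> E\<inverse>" using ab by (auto simp: E_def)
      then show ?thesis unfolding Te using * f by blast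
    next
      case False
      then consider "a \<in> verts G - S" | "b \<in> verts G - S" using aV bV by blast
      then have "\<exists>x y. (x, y) \<in> E \<union> E\<inverse> \<and> f x = a \<and> f y = b"
      proof cases
        case 1 then show ?thesis using leaf_case ab by blast
      next
        case 2
        then obtain x y where "(x, y) \<in> E \<union> E\<inverse>" "f x = b" "f y = a" using leaf_case ab by blast
        then show ?thesis by blast
      qed
      then show ?thesis unfolding Te using * by blast
    qed
  qed
  \<comment> \<open>Arcs of \<open>T\<close> are pairs, arcs of \<open>G\<close> are abstract.
    Without parallel arcs, the ends determine an arc of \<open>G\<close>, and \<open>g\<close>
    selects the one with the ends given by \<open>f\<close>.\<close>
  define g where "g e = the_inv_into (arcs G) (arc_to_ends G) (f (fst e), f (snd e))" for e
  have ends: "(f (fst e), f (snd e)) \<in> arc_to_ends G ` arcs G" if "e \<in> parcs T" for e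
    using that arcs_img unfolding arcs_ends_def by force
  have g_ends: "arc_to_ends G (g e) = (f (fst e), f (snd e))" if "e \<in> parcs T" for e
    unfolding g_def using inj_on_arc_to_ends ends[OF that] by (rule f_the_inv_into_f)
  have g_arc: "g e \<in> arcs G" if "e \<in> parcs T" for e
    unfolding g_def using inj_on_arc_to_ends ends[OF that] by (intro the_inv_into_into) auto
  have T_sub: "parcs T \<subseteq> pverts T \<times> pverts T" using E_sub by (auto simp: Te)
  define h where "h = \<lparr>iso_verts = f, iso_arcs = g, iso_head = head G, iso_tail = tail G\<rparr>"
  have inj_g: "inj_on g (parcs T)"
  proof (rule inj_onI)
    fix d e assume de: "d \<in> parcs T" "e \<in> parcs T" "g d = g e"
    then have "f (fst d) = f (fst e)" "f (snd d) = f (snd e)" using g_ends by (metis prod.inject)+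
    moreover have "fst d \<in> pverts T" "snd d \<in> pverts T" "fst e \<in> pverts T" "snd e \<in> pverts T"
      using de T_sub by auto
    ultimately show "d = e" using inj_f by (simp add: inj_on_eq_iff prod_eq_iff)
  qed
  have "pre_digraph.digraph_isomorphism (with_proj T) h"
    unfolding pre_digraph.digraph_isomorphism_def
  proof (intro conjI ballI)
    show "wf_digraph (with_proj T)" using T_sub by unfold_locales auto
    fix e assume "e \<in> arcs (with_proj T)"
    then have "arc_to_ends G (g e) = (f (fst e), f (snd e))" using g_ends by simp
    then show "iso_verts h (tail (with_proj T) e) = iso_tail h (iso_arcs h e)"
      "iso_verts h (head (with_proj T) e) = iso_head h (iso_arcs h e)"
      by (auto simp: h_def arc_to_ends_def)
  qed (use inj_f inj_g in \<open>auto simp: h_def\<close>)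
  moreover have "G = app_iso h (with_proj T)"
  proof -
    have "arcs G \<subseteq> g ` parcs T"
    proof
      fix a assume a: "a \<in> arcs G"
      then have "arc_to_ends G a \<in> (\<lambda>(x, y). (f x, f y)) ` parcs T"
        unfolding arcs_img arcs_ends_def by blast
      then obtain e where e: "e \<in> parcs T" "arc_to_ends G a = (f (fst e), f (snd e))" by force
      then have "g e = a" using g_ends g_arc a no_multi_arcs by metis
      then show "a \<in> g ` parcs T" using e by blast
    qed
    then have "g ` parcs T = arcs G" using g_arc by blast
    then show ?thesis using img_f by (auto simp: app_iso_def h_def)
  qed
  ultimately have iso: "digraph_iso (with_proj (add_two_leaves H A)) G"
    unfolding digraph_iso_def T_def by blast
  have A_sub: "A \<subseteq> pverts H" by (auto simp: A_def H)
  show ?thesis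
    unfolding in_family_T_def by (intro exI conjI) (rule pg conn A_sub iso)+
qed

text \<open>If \<open>y\<close> missed the second private neighbour of \<open>v\<close>, then
  \<open>v\<close> could be dropped from \<open>S\<close>: a neighbour in \<open>S\<close> observes
  \<open>v\<close>, everything outside \<open>epn S v\<close> is observed, \<open>y\<close> forces
  \<open>x\<close>, and \<open>v\<close> forces the last vertex.\<close>

lemma joined_private_neighbors:
  assumes mS: "min_pds S" and V: "verts G = S \<union> (\<Union>v\<in>S. epn S v)"
    and adjS: "\<And>v. v \<in> S \<Longrightarrow> nbrs v \<inter> S \<noteq> {}"
    and v: "v \<in> S" and x: "x \<in> epn S v" "x \<in> nbrs y" and y: "y \<noteq> v" "y \<notin> epn S v"
    and two: "card (epn S v) = 2"
  shows "epn S v \<subseteq> nbrs y"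
proof (rule ccontr)
  assume n: "\<not> ?thesis"
  have SV: "S \<subseteq> verts G" and pS: "power_dominating_set G S"
    using mS by (auto simp: min_pds_def pds_iff)
  have fS: "finite S" using pS by (rule pds_finite)
  have "card (S - {v}) < card S" using fS v by (meson card_Diff1_less)
  then have npds: "\<not> power_dominating_set G (S - {v})" using mS min_pdsD by blast
  obtain w where w: "w \<in> S - {v}" "v \<in> nbrs w" using adjS[OF v] nbrs_sym nbrs_irrefl by blast
  have rest: "z \<in> obs (S - {v})" if "z \<in> verts G" "z \<notin> epn S v" for z
  proof (cases "z = v")
    case True
    then show ?thesis using w by (auto simp: in_obs)
  next
    case False
    have "z \<in> S \<or> (\<exists>u\<in>S. z \<in> epn S u)" using that V by blast
    then show ?thesis
    proof (elim disjE bexE)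
      fix u assume "u \<in> S" "z \<in> epn S u"
      then have "u \<in> S - {v}" "z \<in> nbrs u" using that epn_adjacent by auto
      then show ?thesis unfolding in_obs by blast
    qed (use False in \<open>simp add: in_obs\<close>)
  qed
  have "verts G \<subseteq> C" if C: "closed C" "obs (S - {v}) \<subseteq> C" for C
  proof -
    have yC: "y \<in> C" using rest y C x nbrs_verts(2) by blast
    have "nbrs y - C \<subseteq> epn S v \<inter> nbrs y" using rest C nbrs_verts(1) by blast
    then have "card (nbrs y - C) \<le> card (epn S v \<inter> nbrs y)" by (intro card_mono) auto
    also have "\<dots> < card (epn S v)" using n by (intro psubset_card_mono) auto
    finally have "nbrs y \<subseteq> C" using closedD[OF C(1) yC] two by simp
    then have xC: "x \<in> C" using x by blast
    have vC: "v \<in> C" using w C by (auto simp: in_obs subset_iff)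
    have "nbrs v - C \<subseteq> epn S v - {x}" using rest C nbrs_verts(1) xC by blast
    then have "card (nbrs v - C) \<le> card (epn S v - {x})" by (intro card_mono) auto
    also have "\<dots> = 1" using x two by simp
    finally have "nbrs v \<subseteq> C" using closedD[OF C(1) vC] by simp
    then show ?thesis using rest C epn_adjacent by blast
  qed
  then show False using npds SV unfolding pds_iff by blast
qed

text \<open>If the private neighbours of \<open>u\<close> and \<open>v\<close> are completely joined, then \<open>u\<close> and \<open>v\<close> can be
  traded for the single vertex \<open>x\<close> unless both conclusions hold.\<close>

lemma joined_pair:
  assumes mS: "min_pds S" and V: "verts G = S \<union> (\<Union>v\<in>S. epn S v)"
    and adjS: "\<And>v. v \<in> S \<Longrightarrow> nbrs v \<inter> S \<noteq> {}"
    and u: "u \<in> S" and v: "v \<in> S" "u \<noteq> v" and two: "card (epn S v) = 2"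
    and x: "x \<in> epn S v" and joined: "epn S u \<subseteq> nbrs x"
  shows "nbrs u \<inter> S = {v}" "nbrs x \<inter> epn S v = {}"
proof -
  have SV: "S \<subseteq> verts G" and pS: "power_dominating_set G S"
    using mS by (auto simp: min_pds_def pds_iff)
  have fS: "finite S" using pS by (rule pds_finite)
  obtain x' where x': "epn S v = {x, x'}" "x' \<noteq> x"
    using two x by (metis card_2_iff doubleton_eq_iff insertE singletonD)
  define S' where "S' = insert x (S - {u, v})"
  have "card (S - {u, v}) = card S - 2"
    using fS u v by (simp add: card_Diff_subset)
  moreover have "card {u, v} \<le> card S" using fS u v by (intro card_mono) auto
  moreover have "card S' = Suc (card (S - {u, v}))"
    using fS x epn_outside[of S v] unfolding S'_def by (intro card_insert_disjoint) auto
  ultimately have "card S' < card S" using v by simp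
  then have "\<not> power_dominating_set G S'" using mS min_pdsD by blast
  moreover have "S' \<subseteq> verts G" using SV x epn_verts by (auto simp: S'_def)
  ultimately obtain C where C: "closed C" "obs S' \<subseteq> C" "\<not> verts G \<subseteq> C"
    unfolding pds_iff by blast
  have vC: "v \<in> C"
    using C(2) nbrs_sym[OF epn_adjacent[OF x]] by (auto simp: in_obs S'_def subset_iff)
  \<comment> \<open>\<open>x\<close> observes \<open>v\<close> and all private neighbours of
    \<open>u\<close>, so only \<open>u\<close> and \<open>x'\<close> can escape.\<close>
  have rest: "z \<in> C" if "z \<in> verts G" "z \<noteq> u" "z \<noteq> x'" for z
  proof (cases "z = v")
    case False
    have "z \<in> S \<or> (\<exists>w\<in>S. z \<in> epn S w)" using that V by blast
    then have "z \<in> obs S'"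
    proof (elim disjE bexE)
      fix w assume w: "w \<in> S" "z \<in> epn S w"
      consider "w = u" | "w = v" | "w \<in> S - {u, v}" using w by blast
      then show ?thesis
      proof cases
        case 1
        then show ?thesis using w joined by (auto simp: in_obs S'_def)
      next
        case 2
        then show ?thesis using w x' that by (auto simp: in_obs S'_def)
      next
        case 3
        then show ?thesis using epn_adjacent[OF w(2)] by (auto simp: in_obs S'_def)
      qed
    qed (use False that in \<open>auto simp: in_obs S'_def\<close>)
    then show ?thesis using C(2) by blast
  qed (use vC in simp)
  have v_sub: "nbrs v - C \<subseteq> {u, x'}" using rest nbrs_verts(1) by blast
  \<comment> \<open>If \<open>u\<close> or \<open>x'\<close> lay in \<open>C\<close>, then
    \<open>v\<close> would have at most one neighbour outside, so \<open>x'\<close> would be in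
    \<open>C\<close>; and so would \<open>u\<close>, as a neighbour of \<open>v\<close> or of a
    member kept in \<open>S'\<close>. Then \<open>C\<close> would be everything.\<close>
  have *: "u \<notin> C \<and> x' \<notin> C"
  proof (rule ccontr)
    assume "\<not> ?thesis"
    then obtain z where "nbrs v - C \<subseteq> {z}" using v_sub by blast
    then have "card (nbrs v - C) \<le> 1" using card_mono[of "{z}"] by fastforce
    then have sub: "nbrs v \<subseteq> C" using closedD[OF C(1) vC] by blast
    then have x'C: "x' \<in> C" using x' epn_adjacent by blast
    show False
    proof (cases "u \<in> C")
      case True
      then show False using rest x'C C(3) by blast
    next
      case False
      then have "u \<notin> nbrs v" using sub by blast
      then obtain w where w: "w \<in> S" "w \<noteq> v" "w \<in> nbrs u"
        using adjS[OF u] nbrs_sym by blast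
      then have "w \<in> S'" using nbrs_irrefl by (auto simp: S'_def)
      then show False using False C(2) nbrs_sym[OF w(3)] by (auto simp: in_obs subset_iff)
    qed
  qed
  have "w = v" if "w \<in> nbrs u \<inter> S" for w
  proof (rule ccontr)
    assume "w \<noteq> v"
    then have "w \<in> S'" using that by (auto simp: S'_def)
    then show False using * C(2) nbrs_sym[of w u] that by (auto simp: in_obs subset_iff)
  qed
  then show "nbrs u \<inter> S = {v}" using adjS[OF u] by blast
  show "nbrs x \<inter> epn S v = {}"
    using * C(2) x' by (auto simp: in_obs S'_def subset_iff)
qed

theorem extremal_structure:
  assumes mS: "min_pds S" and card_V: "card (verts G) = 3 * card S"
    and priv: "\<forall>v\<in>S. 2 \<le> card (epn S v)"
    and deg: "(\<forall>v\<in>S. 2 < card (nbrs v)) \<or> card S = 1"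
  shows "in_family_T G \<or> complete_bipartite_digraph 3 3 G"
proof -
  have SV: "S \<subseteq> verts G" and pS: "power_dominating_set G S"
    using mS by (auto simp: min_pds_def pds_iff)
  have fS: "finite S" and S_ne: "S \<noteq> {}" using pS pds_finite pds_nonempty by auto
  have V: "verts G = S \<union> (\<Union>v\<in>S. epn S v)" and two: "\<And>v. v \<in> S \<Longrightarrow> card (epn S v) = 2"
    using card_private_bound[OF SV priv] card_V by auto
  show ?thesis
  proof (cases "\<forall>v\<in>S. \<forall>x\<in>epn S v. nbrs x \<subseteq> insert v (epn S v)")
    case True
    have "\<forall>v\<in>S. \<exists>p. epn S v = {fst p, snd p} \<and> fst p \<noteq> snd p"
      using two by (auto simp: card_2_iff)
    then obtain p where p: "\<And>v. v \<in> S \<Longrightarrow> epn S v = {fst (p v), snd (p v)} \<and> fst (p v) \<noteq> snd (p v)"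
      using bchoice[of S] by metis
    define l1 l2 where "l1 v = fst (p v)" and "l2 v = snd (p v)" for v
    have l: "epn S v = {l1 v, l2 v}" "l1 v \<noteq> l2 v" if "v \<in> S" for v
      using p that by (auto simp: l1_def l2_def)
    have sep: "l1 u \<noteq> l1 v" "l2 u \<noteq> l2 v" "l1 u \<noteq> l2 v" if "u \<in> S" "v \<in> S" "u \<noteq> v" for u v
      using epn_disjoint[of u S v] l that by auto
    have "in_family_T G"
    proof (rule in_family_T_I[of S l1 l2])
      show "verts G = S \<union> l1 ` S \<union> l2 ` S" using V l by auto
      show "inj_on l1 S" "inj_on l2 S" using sep by (auto simp: inj_on_def)
      show "S \<inter> l1 ` S = {}" "S \<inter> l2 ` S = {}" using epn_outside l by blast+
      have "l1 u \<noteq> l2 v" if "u \<in> S" "v \<in> S" for u v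
        using sep(3) l(2) that by (cases "u = v") auto
      then show "l1 ` S \<inter> l2 ` S = {}" by blast
      show "l1 v \<in> nbrs v" "l2 v \<in> nbrs v" if "v \<in> S" for v
        using l[OF that] epn_adjacent by blast+
      show "nbrs (l1 v) \<subseteq> {v, l2 v}" "nbrs (l2 v) \<subseteq> {v, l1 v}" if "v \<in> S" for v
      proof -
        have "nbrs (l1 v) \<subseteq> {v, l1 v, l2 v}" "nbrs (l2 v) \<subseteq> {v, l1 v, l2 v}"
          using True l(1)[OF that] that by blast+
        then show "nbrs (l1 v) \<subseteq> {v, l2 v}" "nbrs (l2 v) \<subseteq> {v, l1 v}"
          using nbrs_irrefl[of "l1 v"] nbrs_irrefl[of "l2 v"] by blast+
      qed
    qed (use SV S_ne in auto)
    then show ?thesis ..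
  next
    case False
    then obtain v x y where vxy: "v \<in> S" "x \<in> epn S v" "y \<in> nbrs x" "y \<noteq> v" "y \<notin> epn S v"
      by blast
    have "y \<notin> S" using vxy epn_not_adjacent nbrs_sym by blast
    then obtain u where u: "u \<in> S" "y \<in> epn S u" "u \<noteq> v"
      using V vxy nbrs_verts(1) by blast
    \<comment> \<open>Two members exist, so the exceptional case \<open>card S = 1\<close> is ruled
      out.\<close>
    have "card {u, v} \<le> card S" using fS u vxy by (intro card_mono) auto
    then have deg3: "\<And>v. v \<in> S \<Longrightarrow> 2 < card (nbrs v)" using deg u by auto
    \<comment> \<open>Vertices outside \<open>S\<close> are private to some member, so a member
      without neighbours in \<open>S\<close> would have degree two only.\<close>
    have adjS: "nbrs w \<inter> S \<noteq> {}" if w: "w \<in> S" for w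
    proof
      assume "nbrs w \<inter> S = {}"
      have "nbrs w \<subseteq> epn S w"
      proof
        fix z assume z: "z \<in> nbrs w"
        then have "z \<notin> S" using \<open>nbrs w \<inter> S = {}\<close> by blast
        then obtain t where t: "t \<in> S" "z \<in> epn S t" using V nbrs_verts(1)[OF z] by blast
        then have "t = w" using epn_not_adjacent[OF t(2) w] z by blast
        then show "z \<in> epn S w" using t by simp
      qed
      then have "card (nbrs w) \<le> 2"
        using two[OF w] card_mono[of "epn S w" "nbrs w"] by simp
      then show False using deg3[OF w] by simp
    qed
    \<comment> \<open>A single edge spreads both ways: \<open>t\<close> sees all of
      \<open>epn S a\<close>, so every \<open>z\<close> there has the neighbour \<open>t\<close> in
      \<open>epn S b\<close> and hence sees all of \<open>epn S b\<close>.\<close>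
    have join: "epn S b \<subseteq> nbrs z"
      if "a \<in> S" "b \<in> S" "a \<noteq> b" "s \<in> epn S a" "t \<in> epn S b" "t \<in> nbrs s" "z \<in> epn S a" for a b s t z
    proof -
      have "epn S a \<subseteq> nbrs t"
        using that epn_disjoint[of a S b] epn_outside[of S b]
        by (intro joined_private_neighbors[OF mS V adjS, of a s t]) (auto intro: nbrs_sym two)
      then have "t \<in> nbrs z" using that nbrs_sym by blast
      then show ?thesis
        using that epn_disjoint[of a S b] epn_outside[of S a]
        by (intro joined_private_neighbors[OF mS V adjS, of b t z]) (auto intro: two)
    qed
    have pair: "nbrs a \<inter> S = {b}" "nbrs z \<inter> epn S b = {}"
      if "a \<in> S" "b \<in> S" "a \<noteq> b" "s \<in> epn S a" "t \<in> epn S b" "t \<in> nbrs s" "z \<in> epn S b" for a b s t z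
    proof -
      have "epn S a \<subseteq> nbrs z" using join[of b a t s z] that nbrs_sym by blast
      then show "nbrs a \<inter> S = {b}" "nbrs z \<inter> epn S b = {}"
        using joined_pair[OF mS V adjS, of a b z] that two by blast+
    qed
    have leaf: "nbrs z = insert b (epn S a)"
      if "a \<in> S" "b \<in> S" "a \<noteq> b" "s \<in> epn S a" "t \<in> epn S b" "t \<in> nbrs s" "z \<in> epn S b" for a b s t z
    proof
      show "insert b (epn S a) \<subseteq> nbrs z"
        using that epn_adjacent nbrs_sym join[of b a t s z] by blast
      show "nbrs z \<subseteq> insert b (epn S a)"
      proof
        fix w assume w: "w \<in> nbrs z"
        show "w \<in> insert b (epn S a)"
        proof (cases "w \<in> S")
          case True
          then show ?thesis using w that epn_not_adjacent nbrs_sym by blast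
        next
          case False
          then obtain c where c: "c \<in> S" "w \<in> epn S c" using V w nbrs_verts(1) by blast
          \<comment> \<open>An edge from \<open>z\<close> to the triple of \<open>c\<close> makes
            \<open>c\<close> the only neighbour of \<open>b\<close> in \<open>S\<close>; that
            neighbour is \<open>a\<close>.\<close>
          then have "c \<noteq> b" using pair(2)[OF that] w by blast
          then have "nbrs b \<inter> S = {c}" using pair(1)[of b c z w w] that c w by blast
          moreover have "nbrs b \<inter> S = {a}" using pair(1)[of b a t s s] that nbrs_sym by blast
          ultimately show ?thesis using c by simp
        qed
      qed
    qed
    have center: "nbrs a = insert b (epn S a)"
      if "a \<in> S" "nbrs a \<inter> S = {b}" for a b
    proof
      show "insert b (epn S a) \<subseteq> nbrs a" using that epn_adjacent by blast
      show "nbrs a \<subseteq> insert b (epn S a)"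
      proof
        fix z assume z: "z \<in> nbrs a"
        show "z \<in> insert b (epn S a)"
        proof (cases "z \<in> S")
          case True
          then show ?thesis using z that by blast
        next
          case False
          then obtain t where t: "t \<in> S" "z \<in> epn S t" using V nbrs_verts(1)[OF z] by blast
          then have "t = a" using epn_not_adjacent[OF t(2) that(1)] z by blast
          then show ?thesis using t by simp
        qed
      qed
    qed
    have yx: "x \<in> nbrs y" using vxy nbrs_sym by blast
    have nu: "nbrs u = insert v (epn S u)" and nv: "nbrs v = insert u (epn S v)"
      using center pair(1)[of u v y x x] pair(1)[of v u x y y] u vxy yx by blast+
    have nx: "nbrs z = insert v (epn S u)" if "z \<in> epn S v" for z
      using leaf[of u v y x z] u vxy yx that by blast
    have ny: "nbrs z = insert u (epn S v)" if "z \<in> epn S u" for z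
      using leaf[of v u x y z] u vxy yx that by blast
    \<comment> \<open>Each side of K_{3,3} joins one centre to the private neighbours of the
      other.\<close>
    let ?A = "insert v (epn S u)" and ?B = "insert u (epn S v)"
    have nA: "nbrs z = ?B" if "z \<in> ?A" for z using that nv ny by blast
    have nB: "nbrs z = ?A" if "z \<in> ?B" for z using that nu nx by blast
    have "verts G \<subseteq> ?A \<union> ?B"
      using nA nB vxy SV by (intro connected_closed[of v]) auto
    then have VAB: "verts G = ?A \<union> ?B" using SV u vxy epn_verts by blast
    have disj: "?A \<inter> ?B = {}"
      using epn_disjoint[of u S v] epn_outside[of S u] epn_outside[of S v] u vxy by blast
    have cards: "card ?A = 3" "card ?B = 3"
      using two u vxy epn_outside[of S u] epn_outside[of S v]
      by (auto simp: card_insert_if)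
    have "arcs_ends G = ?A \<times> ?B \<union> ?B \<times> ?A"
    proof (intro equalityI subrelI)
      fix s t assume "(s, t) \<in> arcs_ends G"
      then have st: "t \<in> nbrs s" by (simp add: nbrs_def)
      then have "s \<in> ?A \<union> ?B" using VAB nbrs_verts(2) by blast
      then show "(s, t) \<in> ?A \<times> ?B \<union> ?B \<times> ?A" using st nA nB by blast
    next
      fix s t assume "(s, t) \<in> ?A \<times> ?B \<union> ?B \<times> ?A"
      then have "t \<in> nbrs s" using nA nB by blast
      then show "(s, t) \<in> arcs_ends G" by (simp add: nbrs_def)
    qed
    then have "complete_bipartite_digraph 3 3 G"
      unfolding complete_bipartite_digraph_def
      using VAB disj cards graph_axioms by blast
    then show ?thesis ..
  qed
qed


section \<open>Robust power domination\<close>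

lemma robust_number_le:
  "robust_power_dominating_set k G M \<Longrightarrow> robust_power_domination_number k G \<le> size M"
  unfolding robust_power_domination_number_def by (rule Least_le) blast

text \<open>Deleting \<open>k\<close> elements cannot exhaust the \<open>k + 1\<close> copies of any
  member, so the underlying set stays \<open>S\<close>.\<close>

lemma robust_copies:
  assumes "power_dominating_set G S"
  shows "robust_power_dominating_set k G (repeat_mset (k + 1) (mset_set S))"
    and "size (repeat_mset (k + 1) (mset_set S)) = (k + 1) * card S"
proof -
  let ?M = "repeat_mset (k + 1) (mset_set S)"
  have fS: "finite S" and SV: "S \<subseteq> verts G" using assms pds_finite by (auto simp: pds_iff)
  have "S \<noteq> {}" using assms pds_nonempty by blast
  then have "0 < card S" using fS by (simp add: card_gt_0_iff)
  show size: "size ?M = (k + 1) * card S" by simp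
  have mem: "x \<in># ?M \<longleftrightarrow> x \<in> S" for x
    unfolding count_greater_zero_iff[symmetric] count_repeat_mset
    using fS by (cases "x \<in> S") simp_all
  have "set_mset (?M - F) = S" if F: "F \<subseteq># ?M" "size F = k" for F
  proof
    show "set_mset (?M - F) \<subseteq> S" using mem by (meson in_diffD subsetI)
    show "S \<subseteq> set_mset (?M - F)"
    proof
      fix x assume "x \<in> S"
      moreover have "count F x \<le> k" using count_le_size[of F x] F by simp
      ultimately show "x \<in># ?M - F" using fS by (simp add: in_diff_count)
    qed
  qed
  moreover have "set_mset ?M \<subseteq> verts G" using mem SV by blast
  moreover have "k \<le> (k + 1) * card S" using \<open>0 < card S\<close> by (cases "card S") auto
  ultimately show "robust_power_dominating_set k G ?M"
    using assms unfolding robust_power_dominating_set_def size by metis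
qed

lemma robust_number_le_pds:
  "power_dominating_set G S \<Longrightarrow> robust_power_domination_number k G \<le> (k + 1) * card S"
  using robust_copies[of S k] robust_number_le by metis

lemma robust_number_attained:
  obtains M where "robust_power_dominating_set k G M" "size M = robust_power_domination_number k G"
proof -
  have "\<exists>m M. robust_power_dominating_set k G M \<and> size M = m"
    using robust_copies[OF pds_verts] by blast
  then have "\<exists>M. robust_power_dominating_set k G M \<and> size M = robust_power_domination_number k G"
    unfolding robust_power_domination_number_def by (rule LeastI_ex)
  then show ?thesis using that by blast
qed

text \<open>For \<open>k = 0\<close> only the empty multiset is deleted, so repeated elements merely
  add to the size.\<close>

lemma robust_number_0:
  assumes "min_pds S"
  shows "robust_power_domination_number 0 G = card S"
proof (rule antisym)
  show "robust_power_domination_number 0 G \<le> card S"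
    using robust_number_le_pds[of S 0] assms by (simp add: min_pds_def)
  obtain M where M: "robust_power_dominating_set 0 G M" "size M = robust_power_domination_number 0 G"
    using robust_number_attained by blast
  then have "power_dominating_set G (set_mset M)" by (simp add: robust_power_dominating_set_def)
  then have "card S \<le> card (set_mset M)" using assms by (simp add: min_pds_def)
  also have "\<dots> \<le> size M"
    unfolding size_multiset_overloaded_eq
    using sum_mono[of "set_mset M" "\<lambda>_. 1" "count M"] by simp
  finally show "card S \<le> robust_power_domination_number 0 G" using M by simp
qed

text \<open>If \<open>S\<close> avoided the triple, the vertices other than \<open>x\<close> and
  \<open>y\<close> would form a closed set around \<open>obs S\<close>: \<open>v\<close> has two
  neighbours outside it, every other vertex none.\<close>

lemma twin_leaves_block:
  assumes pds: "power_dominating_set G S" and "x \<in> verts G" "x \<noteq> y" "v \<noteq> x" "v \<noteq> y"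
    and adj: "x \<in> nbrs v" "y \<in> nbrs v" "nbrs x \<subseteq> {v, y}" "nbrs y \<subseteq> {v, x}"
  shows "S \<inter> {v, x, y} \<noteq> {}"
proof
  assume S: "S \<inter> {v, x, y} = {}"
  let ?C = "verts G - {x, y}"
  have "card (nbrs w - ?C) \<noteq> 1" if "w \<in> ?C" for w
  proof (cases "w = v")
    case True
    then have "nbrs w - ?C = {x, y}" using adj nbrs_verts(1) by blast
    then show ?thesis using assms by simp
  next
    case False
    have "x \<notin> nbrs w" "y \<notin> nbrs w" using adj nbrs_sym False that by blast+
    then have "nbrs w - ?C = {}" using nbrs_verts(1) by blast
    then show ?thesis by (metis card.empty zero_neq_one)
  qed
  then have "closed ?C" by (auto simp: closed_def)
  moreover have "obs S \<subseteq> ?C"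
  proof
    fix z assume z: "z \<in> obs S"
    have "x \<notin> nbrs w" "y \<notin> nbrs w" if "w \<in> S" for w using that S adj nbrs_sym by blast+
    then have "z \<notin> {x, y}" using z S by (auto simp: in_obs)
    then show "z \<in> ?C" using z obs_verts pds by (auto simp: pds_iff)
  qed
  ultimately have "verts G \<subseteq> ?C" using pds by (auto simp: pds_iff)
  then show False using assms by blast
qed

text \<open>The isomorphism is unpacked into three injections with disjoint images, so that the
  lower bound can be argued within \<open>G\<close> alone.\<close>

lemma in_family_T_E:
  assumes "in_family_T G"
  obtains I :: "'a set" and b l1 l2 where "finite I" "verts G = b ` I \<union> l1 ` I \<union> l2 ` I"
    "inj_on b I" "inj_on l1 I" "inj_on l2 I"
    "\<And>i j. i \<in> I \<Longrightarrow> j \<in> I \<Longrightarrow> b i \<noteq> l1 j \<and> b i \<noteq> l2 j \<and> l1 i \<noteq> l2 j"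
    "\<And>i. i \<in> I \<Longrightarrow> l1 i \<in> nbrs (b i) \<and> l2 i \<in> nbrs (b i)"
    "\<And>i. i \<in> I \<Longrightarrow> nbrs (l1 i) \<subseteq> {b i, l2 i} \<and> nbrs (l2 i) \<subseteq> {b i, l1 i}"
proof -
  obtain H :: "'a pair_pre_digraph" and A where H: "pair_graph H" "A \<subseteq> pverts H"
    and iso: "digraph_iso (with_proj (add_two_leaves H A)) G"
    using assms unfolding in_family_T_def by blast
  interpret H: pair_graph H by (rule H)
  define T where "T = add_two_leaves H A"
  obtain h where h: "pre_digraph.digraph_isomorphism (with_proj T) h" "G = app_iso h (with_proj T)"
    using iso unfolding digraph_iso_def T_def by blast
  define f where "f = iso_verts h"
  have V: "verts G = f ` pverts T" by (simp add: h f_def)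
  have Tv: "pverts T = Base ` pverts H \<union> Leaf1 ` pverts H \<union> Leaf2 ` pverts H"
    by (simp add: T_def add_two_leaves_def Let_def)
  have inj_f: "inj_on f (pverts T)"
    using h(1) by (simp add: pre_digraph.digraph_isomorphism_def f_def)
  have f_eq: "f x = f y \<longleftrightarrow> x = y" if "x \<in> pverts T" "y \<in> pverts T" for x y
    using inj_f that by (auto simp: inj_on_def)
  have wf: "wf_digraph (with_proj T)"
    using h(1) by (simp add: pre_digraph.digraph_isomorphism_def)
  then have T_sub: "x \<in> pverts T \<and> y \<in> pverts T" if "(x, y) \<in> parcs T" for x y
    using that wf_digraph.wellformed[of "with_proj T" "(x, y)"] by simp
  have "arcs_ends G = (\<lambda>(u, v). (f u, f v)) ` parcs T"
    using wf_digraph.arcs_ends_app_iso_eq[OF wf h(1)] h(2) by (simp add: f_def)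
  then have NT: "nbrs (f x) = {f y |y. (x, y) \<in> parcs T}" if "x \<in> pverts T" for x
    using that T_sub f_eq by (auto simp: nbrs_def)
  have AT:
    "{y. (Base i, y) \<in> parcs T} \<supseteq> {Leaf1 i, Leaf2 i}"
    "{y. (Leaf1 i, y) \<in> parcs T} \<subseteq> {Base i, Leaf2 i}"
    "{y. (Leaf2 i, y) \<in> parcs T} \<subseteq> {Base i, Leaf1 i}" if "i \<in> pverts H" for i
    using that by (auto simp: T_def add_two_leaves_def Let_def)
  have mem: "Base i \<in> pverts T" "Leaf1 i \<in> pverts T" "Leaf2 i \<in> pverts T" if "i \<in> pverts H" for i
    using that by (simp_all add: Tv)
  have N: "f (Leaf1 i) \<in> nbrs (f (Base i)) \<and> f (Leaf2 i) \<in> nbrs (f (Base i))"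
    "nbrs (f (Leaf1 i)) \<subseteq> {f (Base i), f (Leaf2 i)} \<and> nbrs (f (Leaf2 i)) \<subseteq> {f (Base i), f (Leaf1 i)}"
    if "i \<in> pverts H" for i
    unfolding NT[OF mem(1)[OF that]] NT[OF mem(2)[OF that]] NT[OF mem(3)[OF that]]
    using AT[OF that] by blast+
  show ?thesis
  proof (rule that[of "pverts H" "f \<circ> Base" "f \<circ> Leaf1" "f \<circ> Leaf2"])
    show "verts G = (f \<circ> Base) ` pverts H \<union> (f \<circ> Leaf1) ` pverts H \<union> (f \<circ> Leaf2) ` pverts H"
      unfolding V Tv by (simp add: image_Un image_image)
    show "inj_on (f \<circ> Base) (pverts H)" "inj_on (f \<circ> Leaf1) (pverts H)" "inj_on (f \<circ> Leaf2) (pverts H)"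
      by (intro comp_inj_on inj_on_subset[OF inj_f]; auto simp: inj_on_def Tv)+
    show "(f \<circ> Base) i \<noteq> (f \<circ> Leaf1) j \<and> (f \<circ> Base) i \<noteq> (f \<circ> Leaf2) j \<and> (f \<circ> Leaf1) i \<noteq> (f \<circ> Leaf2) j"
      if "i \<in> pverts H" "j \<in> pverts H" for i j
      using that f_eq[of "Base i" "Leaf1 j"] f_eq[of "Base i" "Leaf2 j"] f_eq[of "Leaf1 i" "Leaf2 j"]
      by (simp add: Tv)
  qed (use N H.pair_finite_verts in auto)
qed

text \<open>Each triple consisting of a vertex and its two leaves contains more than \<open>k\<close> elements,
  as removing all of them would destroy power domination.\<close>

lemma family_T_lower_bound:
  assumes "in_family_T G" and M: "robust_power_dominating_set k G M"
  shows "(k + 1) * card (verts G) \<le> 3 * size M"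
proof -
  obtain I :: "'a set" and b l1 l2 where I: "finite I" and V: "verts G = b ` I \<union> l1 ` I \<union> l2 ` I"
    and inj: "inj_on b I" "inj_on l1 I" "inj_on l2 I"
    and disj: "\<And>i j. i \<in> I \<Longrightarrow> j \<in> I \<Longrightarrow> b i \<noteq> l1 j \<and> b i \<noteq> l2 j \<and> l1 i \<noteq> l2 j"
    and adj: "\<And>i. i \<in> I \<Longrightarrow> l1 i \<in> nbrs (b i) \<and> l2 i \<in> nbrs (b i)"
    and leaf: "\<And>i. i \<in> I \<Longrightarrow> nbrs (l1 i) \<subseteq> {b i, l2 i} \<and> nbrs (l2 i) \<subseteq> {b i, l1 i}"
    using in_family_T_E[OF assms(1)] by metis
  define c where "c i = count M (b i) + count M (l1 i) + count M (l2 i)" for i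
  have "k + 1 \<le> c i" if i: "i \<in> I" for i
  proof (rule ccontr)
    assume "\<not> ?thesis"
    then have ck: "c i \<le> k" by simp
    let ?t = "{b i, l1 i, l2 i}"
    define F where "F = filter_mset (\<lambda>x. x \<in> ?t) M"
    have ne: "b i \<noteq> l1 i" "b i \<noteq> l2 i" "l1 i \<noteq> l2 i" using disj i by auto
    have "size F = (\<Sum>x\<in>?t. count F x)"
      unfolding size_multiset_overloaded_eq
      by (intro sum.mono_neutral_left) (auto simp: F_def count_eq_zero_iff)
    also have "\<dots> = c i" using ne by (simp add: F_def c_def)
    finally have "size F \<le> k" using ck by simp
    moreover have "F \<subseteq># M" by (simp add: F_def)
    moreover have "k \<le> size M" using M by (simp add: robust_power_dominating_set_def)
    \<comment> \<open>Exactly \<open>k\<close> elements must be deleted, so \<open>F\<close> is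
      padded with arbitrary further elements \<open>D\<close>.\<close>
    ultimately have "k - size F \<le> size (M - F)" by (simp add: size_Diff_submset)
    then obtain D where D: "D \<subseteq># M - F" "size D = k - size F"
      using submset_of_size_exists by blast
    have "F + D \<subseteq># M"
      using D(1) \<open>F \<subseteq># M\<close> by (metis subset_mset.add_le_cancel_left subset_mset.add_diff_inverse)
    moreover have "size (F + D) = k" using D(2) \<open>size F \<le> k\<close> by simp
    ultimately have "power_dominating_set G (set_mset (M - (F + D)))"
      using M by (simp add: robust_power_dominating_set_def)
    then have "set_mset (M - (F + D)) \<inter> ?t \<noteq> {}"
      using twin_leaves_block[of _ "l1 i" "l2 i" "b i"] ne adj[OF i] leaf[OF i] nbrs_verts(1)
      by metis
    then obtain x where x: "x \<in># M - (F + D)" "x \<in> ?t" by blast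
    then have "count F x = count M x" by (simp add: F_def)
    then show False using x(1) by (simp add: in_diff_count)
  qed
  then have "card I * (k + 1) \<le> (\<Sum>i\<in>I. c i)" using sum_bounded_below[of I "k + 1" c] by simp
  then have "(k + 1) * card I \<le> (\<Sum>i\<in>I. c i)" by (simp only: mult.commute)
  also have "\<dots> = (\<Sum>x\<in>b ` I. count M x) + (\<Sum>x\<in>l1 ` I. count M x) + (\<Sum>x\<in>l2 ` I. count M x)"
    using inj by (simp add: c_def sum.distrib sum.reindex)
  also have "\<dots> = (\<Sum>x\<in>verts G. count M x)"
  proof -
    have "b ` I \<inter> l1 ` I = {}" "(b ` I \<union> l1 ` I) \<inter> l2 ` I = {}" using disj by blast+
    then show ?thesis using I unfolding V by (simp add: sum.union_disjoint)
  qed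
  also have "\<dots> = size M"
    using M unfolding size_multiset_overloaded_eq robust_power_dominating_set_def
    by (intro sum.mono_neutral_right) (auto simp: count_eq_zero_iff)
  finally have low: "(k + 1) * card I \<le> size M" .
  have "card (verts G) \<le> card (b ` I) + card (l1 ` I) + card (l2 ` I)"
    unfolding V by (meson add_le_mono1 card_Un_le le_trans)
  also have "\<dots> = 3 * card I" using inj by (simp add: card_image)
  finally have "(k + 1) * card (verts G) \<le> (k + 1) * (3 * card I)" by (rule mult_le_mono2)
  then show ?thesis using low by linarith
qed

section \<open>The graph K_{3,3}\<close>

lemma K33_nbrs:
  assumes "complete_bipartite_digraph 3 3 G"
  obtains U W where "verts G = U \<union> W" "U \<inter> W = {}" "card U = 3" "card W = 3"
    "\<forall>v\<in>U. nbrs v = W" "\<forall>v\<in>W. nbrs v = U"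
proof -
  obtain U W where *: "verts G = U \<union> W" "U \<inter> W = {}" "card U = 3" "card W = 3"
    "arcs_ends G = U \<times> W \<union> W \<times> U"
    using assms by (auto simp: complete_bipartite_digraph_def)
  then show ?thesis using that[of U W] unfolding nbrs_def by blast
qed

lemma K33_card:
  assumes "complete_bipartite_digraph 3 3 G"
  shows "card (verts G) = 6"
proof -
  obtain U W where "verts G = U \<union> W" "U \<inter> W = {}" "card U = 3" "card W = 3"
    "\<forall>v\<in>U. nbrs v = W" "\<forall>v\<in>W. nbrs v = U"
    by (rule K33_nbrs[OF assms])
  then show ?thesis by (simp add: card_Un_disjoint card_ge_0_finite)
qed

text \<open>Forcing stalls at once: \<open>v\<close> and the opposite side are observed, and each
  vertex of that side has two unobserved neighbours.\<close>

lemma K33_singleton_not_pds: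
  assumes "complete_bipartite_digraph 3 3 G"
  shows "\<not> power_dominating_set G {v}"
proof
  assume pds: "power_dominating_set G {v}"
  have False if UW: "verts G = U \<union> W" "U \<inter> W = {}" "card U = 3" "v \<in> U"
    "\<forall>v\<in>U. nbrs v = W" "\<forall>v\<in>W. nbrs v = U" for U W
  proof -
    have 2: "card (U - {v}) = 2" using UW by simp
    have "nbrs w - insert v W = U - {v}" if "w \<in> W" for w using UW that by blast
    moreover have "nbrs v - insert v W = {}" using UW by blast
    ultimately have "card (nbrs w - insert v W) \<noteq> 1" if "w \<in> insert v W" for w
      using that 2 by (metis card.empty insertE one_neq_zero numeral_eq_one_iff semiring_norm(85))
    then have "closed (insert v W)" using UW by (auto simp: closed_def)
    moreover have "obs {v} \<subseteq> insert v W" using UW by (auto simp: in_obs)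
    ultimately have "U \<subseteq> insert v W" using pds UW(1) by (auto simp: pds_iff)
    then have "U - {v} = {}" using UW by blast
    then show False using 2 by (metis card.empty zero_neq_numeral)
  qed
  note side = this
  obtain U W where UW: "verts G = U \<union> W" "U \<inter> W = {}" "card U = 3" "card W = 3"
    "\<forall>v\<in>U. nbrs v = W" "\<forall>v\<in>W. nbrs v = U"
    by (rule K33_nbrs[OF assms])
  have "v \<in> U \<or> v \<in> W" using pds UW(1) by (auto simp: pds_iff)
  then show False
  proof
    assume "v \<in> U"
    then show False using side[of U W] UW by simp
  next
    assume "v \<in> W"
    then show False using side[of W U] UW by (simp add: Un_commute Int_commute)
  qed
qed

text \<open>Two vertices on different sides observe everything. Two on the same side observe the
  other side, where any vertex has at most one neighbour left to force.\<close>

lemma K33_pair_pds: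
  assumes "complete_bipartite_digraph 3 3 G"
    and S: "S \<subseteq> verts G" "p \<in> S" "q \<in> S" "p \<noteq> q"
  shows "power_dominating_set G S"
  unfolding pds_iff
proof (intro conjI allI impI)
  fix C assume C: "closed C" "obs S \<subseteq> C"
  have sees: "nbrs p \<subseteq> C" "nbrs q \<subseteq> C" "p \<in> C" "q \<in> C"
    using C S by (auto simp: in_obs subset_iff)
  have same_side: "U \<union> W \<subseteq> C" if UW: "card U = 3" "card W = 3" "p \<in> U" "q \<in> U"
    "\<forall>v\<in>U. nbrs v = W" "\<forall>v\<in>W. nbrs v = U" for U W
  proof -
    have WC: "W \<subseteq> C" using sees UW by blast
    obtain w where w: "w \<in> W" using UW(2) by fastforce
    have "card {p, q} = 2" using S by simp
    then have "card (U - {p, q}) = 1" using UW by (simp add: card_Diff_subset)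
    moreover have "finite U" using UW(1) by (simp add: card_ge_0_finite)
    moreover have "nbrs w - C \<subseteq> U - {p, q}" using UW(6) w sees by blast
    ultimately have "card (nbrs w - C) \<le> 1" by (metis card_mono finite_Diff)
    then show ?thesis using closedD[OF C(1)] w WC UW(6) w by blast
  qed
  obtain U W where UW: "verts G = U \<union> W" "U \<inter> W = {}" "card U = 3" "card W = 3"
    "\<forall>v\<in>U. nbrs v = W" "\<forall>v\<in>W. nbrs v = U"
    by (rule K33_nbrs[OF assms(1)])
  have "p \<in> U \<union> W" "q \<in> U \<union> W" using S UW(1) by auto
  then consider "p \<in> U" "q \<in> U" | "p \<in> W" "q \<in> W" | "p \<in> U" "q \<in> W" | "p \<in> W" "q \<in> U" by blast
  then show "verts G \<subseteq> C"
  proof cases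
    case 1 then show ?thesis using same_side[OF UW(3,4) 1 UW(5,6)] UW(1) by simp
  next
    case 2 then show ?thesis using same_side[OF UW(4,3) 2 UW(6,5)] UW(1) by (simp add: Un_commute)
  next
    case 3 then show ?thesis using sees UW by blast
  next
    case 4 then show ?thesis using sees UW by blast
  qed
qed (use S in auto)

lemma K33_power_domination_number:
  assumes K: "complete_bipartite_digraph 3 3 G" and S: "min_pds S"
  shows "card S = 2"
proof -
  have pS: "power_dominating_set G S" using S by (simp add: min_pds_def)
  have fS: "finite S" using pS by (rule pds_finite)
  have "card S \<noteq> 0" using pS pds_nonempty fS by auto
  moreover have "card S \<noteq> 1" using pS K33_singleton_not_pds[OF K] by (auto simp: card_1_singleton_iff)
  moreover have "card S \<le> 2"
  proof -
    obtain R where R: "R \<subseteq> verts G" "card R = 2"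
      using obtain_subset_with_card_n[of 2 "verts G"] K33_card[OF K] by auto
    then obtain p q where "R = {p, q}" "p \<noteq> q" by (auto simp: card_2_iff)
    then have "power_dominating_set G R" using K33_pair_pds[OF K, of R p q] R by blast
    then show ?thesis using S R by (auto simp: min_pds_def)
  qed
  ultimately show ?thesis by linarith
qed

text \<open>Any two distinct vertices suffice, so \<open>k\<close>, \<open>k\<close> and \<open>1\<close> copies of three vertices form a robust
  power dominating set that beats \<open>k + 1\<close> copies of two vertices.\<close>

lemma K33_robust_number:
  assumes K: "complete_bipartite_digraph 3 3 G" and "1 \<le> k"
  shows "robust_power_domination_number k G \<le> 2 * k + 1"
proof -
  obtain R where R: "R \<subseteq> verts G" "card R = 3"
    using obtain_subset_with_card_n[of 3 "verts G"] K33_card[OF K] by auto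
  then obtain a b c where abc: "R = {a, b, c}" "a \<noteq> b" "a \<noteq> c" "b \<noteq> c" by (auto simp: card_3_iff)
  define M where "M = replicate_mset k a + replicate_mset k b + {#c#}"
  have sz: "size M = 2 * k + 1" by (simp add: M_def)
  have MV: "set_mset M \<subseteq> verts G" using R abc by (auto simp: M_def)
  \<comment> \<open>Here \<open>1 \<le> k\<close> matters, because of the single copy of
    \<open>c\<close>. As \<open>k + 1\<close> elements survive a deletion, they cannot all be copies
    of one vertex.\<close>
  have cnt: "count M x \<le> k" for x using abc assms(2) by (simp add: M_def)
  have "power_dominating_set G (set_mset (M - F))" if F: "F \<subseteq># M" "size F = k" for F
  proof -
    have size: "size (M - F) = k + 1" using F sz by (simp add: size_Diff_submset)
    then obtain p where p: "p \<in># M - F" by (metis Suc_eq_plus1 size_eq_Suc_imp_elem)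
    have "\<exists>q. q \<in># M - F \<and> q \<noteq> p"
    proof (rule ccontr)
      assume "\<not> ?thesis"
      then have "set_mset (M - F) = {p}" using p by blast
      then have "size (M - F) = count (M - F) p" by (simp add: size_multiset_overloaded_eq)
      also have "\<dots> \<le> k" using cnt[of p] by simp
      finally show False using size by simp
    qed
    then obtain q where "q \<in># M - F" "q \<noteq> p" by blast
    moreover have "set_mset (M - F) \<subseteq> verts G" using MV by (auto dest: in_diffD)
    ultimately show ?thesis using K33_pair_pds[OF K] p by blast
  qed
  then have "robust_power_dominating_set k G M"
    using MV sz by (simp add: robust_power_dominating_set_def)
  then show ?thesis using robust_number_le sz by metis
qed

end

theorem corollary3p7:
  fixes G :: "('a, 'b) pre_digraph"
  assumes "graph G" and "Digraph_Component.connected G" and "card (verts G) \<ge> 3"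
  shows "(\<forall>k. real (robust_power_domination_number k G) \<le> (real k + 1) * (real (card (verts G)) / 3))
    \<and> (real (robust_power_domination_number 0 G) = real (card (verts G)) / 3
         \<longleftrightarrow> in_family_T G \<or> complete_bipartite_digraph 3 3 G)
    \<and> (\<forall>k\<ge>1. real (robust_power_domination_number k G) = (real k + 1) * (real (card (verts G)) / 3)
         \<longleftrightarrow> in_family_T G)"
proof -
  interpret connected_graph G
    using assms by (simp add: connected_graph_def connected_graph_axioms_def)
  let ?n = "card (verts G)" and ?r = "\<lambda>k. robust_power_domination_number k G"
  obtain S where S: "min_pds S" and priv: "\<forall>v\<in>S. 2 \<le> card (epn S v)"
    and deg: "(\<forall>v\<in>S. 2 < card (nbrs v)) \<or> card S = 1"
    using private_neighbors[OF assms(3)] by blast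
  have pS: "power_dominating_set G S" using S by (simp add: min_pds_def)
  have bound: "3 * card S \<le> ?n"
    using card_private_bound(1)[OF _ priv] pS by (simp add: pds_iff)
  have up: "3 * ?r k \<le> (k + 1) * ?n" for k
  proof -
    have "3 * ?r k \<le> 3 * ((k + 1) * card S)" using robust_number_le_pds[OF pS] by (rule mult_le_mono2)
    also have "\<dots> \<le> (k + 1) * ?n" using mult_le_mono2[OF bound, of "k + 1"] by simp
    finally show ?thesis .
  qed
  have T: "3 * ?r k = (k + 1) * ?n" if "in_family_T G" for k
  proof -
    obtain M where "robust_power_dominating_set k G M" "size M = ?r k"
      using robust_number_attained by blast
    then show ?thesis using family_T_lower_bound[OF that] up[of k] by fastforce
  qed
  \<comment> \<open>Since \<open>(k + 1) * card S\<close> bounds the number from above, equality for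
    any single \<open>k\<close> already forces \<open>card (verts G) = 3 * card S\<close>.\<close>
  have ext: "in_family_T G \<or> complete_bipartite_digraph 3 3 G" if "3 * ?r k = (k + 1) * ?n" for k
  proof -
    have "(k + 1) * ?n \<le> (k + 1) * (3 * card S)" using robust_number_le_pds[OF pS, of k] that by simp
    then have "?n = 3 * card S" using bound by (simp del: mult_Suc add: mult_le_cancel1)
    then show ?thesis using extremal_structure[OF S _ priv deg] by blast
  qed
  have real_eq: "real (?r k) = (real k + 1) * (real ?n / 3) \<longleftrightarrow> 3 * ?r k = (k + 1) * ?n" for k
  proof -
    have "real (?r k) = (real k + 1) * (real ?n / 3) \<longleftrightarrow> real (3 * ?r k) = real ((k + 1) * ?n)"
      by (auto simp: field_simps)
    then show ?thesis unfolding of_nat_eq_iff .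
  qed
  have K0: "3 * ?r 0 = ?n" if "complete_bipartite_digraph 3 3 G"
    using robust_number_0[OF S] K33_power_domination_number[OF that S] K33_card[OF that] by simp
  \<comment> \<open>Equality would need \<open>6 * k + 6\<close>, but three times the number is at
    most \<open>6 * k + 3\<close>.\<close>
  have K1: "3 * ?r k \<noteq> (k + 1) * ?n" if "complete_bipartite_digraph 3 3 G" "1 \<le> k" for k
    using K33_robust_number[OF that] K33_card[OF that(1)] by simp
  have "real (?r k) \<le> (real k + 1) * (real ?n / 3)" for k
  proof -
    have "real (3 * ?r k) \<le> real ((k + 1) * ?n)" using up[of k] by (rule of_nat_mono)
    then show ?thesis by (simp add: field_simps)
  qed
  moreover have "real (?r 0) = real ?n / 3 \<longleftrightarrow> in_family_T G \<or> complete_bipartite_digraph 3 3 G"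
    using real_eq[of 0] ext[of 0] T[of 0] K0 by auto
  moreover have "real (?r k) = (real k + 1) * (real ?n / 3) \<longleftrightarrow> in_family_T G" if "1 \<le> k" for k
    using real_eq[of k] ext[of k] T[of k] K1 that by blast
  ultimately show ?thesis by blast
qed

end
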